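(* Let $(x^k)_{k\in\mathbb{N}}$ be the sequence generated by the PSS Method (with subgradients $u^k\in\partial f(x^k)$) with the stepsizes $\alpha_k$ constant equal to $\alpha$. Let $(f+g)^k_{\rm best}:=\min_{0\le i\le k}(f+g)(x^i)$ and let $\bar x^k:=\frac{1}{\sum_{i=0}^k\alpha_i}\sum_{i=0}^k\alpha_i x^i$ be the ergodic sequence. Let $S_*$ be the set of minimizers of $f+g$ over $\mathcal{H}$. Then the iteration attains the optimal rate at $$\alpha=\frac{\operatorname{dist}(x^0,S_* )}{\sqrt{C_k}}\cdot\frac{1}{\sqrt{k+1}},$$ i.e., for all $k\in\mathbb{N}$, $$(f+g)^k_{\rm best}-\min_{x\in\mathcal{H}}(f+g)(x)\le\frac{[\operatorname{dist}(x^0,S_* )]^2+\alpha^2(k+1)C_k}{2(k+1)\alpha}\le\frac{\operatorname{dist}(x^0,S_* )\cdot\sqrt{C_k}}{\sqrt{k+1}}$$ and $$(f+g)(\bar x^k)-\min_{x\in\mathcal{H}}(f+g)(x)\le\frac{[\operatorname{dist}(x^0,S_* )]^2+\alpha^2(k+1)C_k}{2(k+1)\alpha}\le\frac{\operatorname{dist}(x^0,S_* )\cdot\sqrt{C_k}}{\sqrt{k+1}},$$ where $C_k=\max\{\|u^i+w^i\|^2:0\le i\le k\}$ with $w^i\in\partial g(x^i)$ $(i=0,\dots,k)$ arbitrary.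
   Context: Setting. $\mathcal{H}$ is a nontrivial real Hilbert space; $f,g:\mathcal{H}\to\mathbb{R}\cup\{+\infty\}$ are proper, lower semicontinuous and convex, with $\operatorname{dom}(g)\subseteq\operatorname{dom}(f)$, where $\operatorname{dom}(h)=\{x: h(x)<+\infty\}$. $\partial$ denotes the convex subdifferential, $\mathbb{N}=\{0,1,2,\dots\}$, $\mathbb{B}[0;r]$ is the closed ball of radius $r$ centered at $0$, and $\operatorname{dist}(x,S)=\inf_{y\in S}\|x-y\|$. Standing assumptions: A1: $\partial f$ is bounded on bounded sets of $\operatorname{dom}(g)$: for every bounded and closed $V\subseteq\operatorname{dom}(g)$ there is $\zeta>0$ with $\partial f(x)\subseteq\mathbb{B}[0;\zeta]$ for all $x\in V$. A2: there is $\rho\ge 0$ such that $\partial g(x)\cap\mathbb{B}[0;\rho]\ne\emptyset$ for all $x\in\operatorname{dom}(g)$. For $\alpha>0$, $\operatorname{prox}_{\alpha g}(z)$ is the unique minimizer over $y\in\mathcal{H}$ of $\alpha g(y)+\frac12\|y-z\|^2$. PSS Method (Proximal Subgradient Splitting Method): take $x^0\in\operatorname{dom}(g)$ and, for $k\in\mathbb{N}$, set $x^{k+1}=\operatorname{prox}_{\alpha_k g}(x^k-\alpha_k u^k)$, where $u^k\in\partial f(x^k)$ and the stepsize $\alpha_k$ is positive. The method stops if $x^{k+1}=x^k$; it is assumed that it never stops, so that $(x^k)_{k\in\mathbb{N}}$ is an infinite sequence. *)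

theory Defs
  imports "HOL-Analysis.Analysis"
begin

text \<open>Functions \<open>\<H> \<rightarrow> \<real> \<union> {+\<infinity>}\<close> are modelled as \<^typ>\<open>ereal\<close>-valued functions;
  the value \<open>-\<infinity>\<close> is excluded by \<open>proper\<close>.\<close>

definition edom :: "('a \<Rightarrow> ereal) \<Rightarrow> 'a set" where
  "edom h = {x. h x < \<infinity>}"

definition proper :: "('a \<Rightarrow> ereal) \<Rightarrow> bool" where
  "proper h \<longleftrightarrow> (\<forall>x. h x \<noteq> -\<infinity>) \<and> edom h \<noteq> {}"

definition lower_semicontinuous :: "('a::topological_space \<Rightarrow> ereal) \<Rightarrow> bool" where
  "lower_semicontinuous h \<longleftrightarrow> (\<forall>x. h x \<le> Liminf (at x) h)"

definition convex_fun :: "('a::real_vector \<Rightarrow> ereal) \<Rightarrow> bool" where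
  "convex_fun h \<longleftrightarrow> (\<forall>x y. \<forall>t::real. 0 < t \<and> t < 1 \<longrightarrow>
     h ((1 - t) *\<^sub>R x + t *\<^sub>R y) \<le> ereal (1 - t) * h x + ereal t * h y)"

definition subdiff :: "('a::real_inner \<Rightarrow> ereal) \<Rightarrow> 'a \<Rightarrow> 'a set" where
  "subdiff h x = {v. \<forall>y. h x + ereal (v \<bullet> (y - x)) \<le> h y}"

definition minimizers :: "('a \<Rightarrow> ereal) \<Rightarrow> 'a set" where
  "minimizers h = {x. \<forall>y. h x \<le> h y}"

definition prox :: "real \<Rightarrow> ('a::real_inner \<Rightarrow> ereal) \<Rightarrow> 'a \<Rightarrow> 'a" where
  "prox \<alpha> g z = (THE p. p \<in> minimizers (\<lambda>y. ereal \<alpha> * g y + ereal (1 / 2 * (norm (y - z))\<^sup>2)))"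

definition subdiff_bounded_on_bounded ::
    "('a::real_inner \<Rightarrow> ereal) \<Rightarrow> ('a \<Rightarrow> ereal) \<Rightarrow> bool" where
  "subdiff_bounded_on_bounded f g \<longleftrightarrow>
     (\<forall>V. bounded V \<and> closed V \<and> V \<subseteq> edom g \<longrightarrow>
        (\<exists>\<zeta>>0. \<forall>x\<in>V. subdiff f x \<subseteq> cball 0 \<zeta>))"

definition bounded_subgradient_selection :: "('a::real_inner \<Rightarrow> ereal) \<Rightarrow> bool" where
  "bounded_subgradient_selection g \<longleftrightarrow>
     (\<exists>\<rho>\<ge>0. \<forall>x\<in>edom g. subdiff g x \<inter> cball 0 \<rho> \<noteq> {})"

text \<open>The last conjunct says that the stopping test \<open>x (Suc k) = x k\<close> never succeeds.\<close>

definition PSS :: "('a::real_inner \<Rightarrow> ereal) \<Rightarrow> ('a \<Rightarrow> ereal) \<Rightarrow> (nat \<Rightarrow> real)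
    \<Rightarrow> (nat \<Rightarrow> 'a) \<Rightarrow> (nat \<Rightarrow> 'a) \<Rightarrow> bool" where
  "PSS f g \<alpha> u x \<longleftrightarrow>
     x 0 \<in> edom g \<and>
     (\<forall>k. \<alpha> k > 0) \<and>
     (\<forall>k. u k \<in> subdiff f (x k)) \<and>
     (\<forall>k. x (Suc k) = prox (\<alpha> k) g (x k - \<alpha> k *\<^sub>R u k)) \<and>
     (\<forall>k. x (Suc k) \<noteq> x k)"

definition best_value :: "('a \<Rightarrow> ereal) \<Rightarrow> (nat \<Rightarrow> 'a) \<Rightarrow> nat \<Rightarrow> ereal" where
  "best_value h x k = Min ((\<lambda>i. h (x i)) ` {0..k})"

definition ergodic :: "(nat \<Rightarrow> real) \<Rightarrow> (nat \<Rightarrow> 'a::real_vector) \<Rightarrow> nat \<Rightarrow> 'a" where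
  "ergodic \<alpha> x k = (1 / (\<Sum>i=0..k. \<alpha> i)) *\<^sub>R (\<Sum>i=0..k. \<alpha> i *\<^sub>R x i)"

definition max_sq_norm :: "(nat \<Rightarrow> 'a::real_normed_vector) \<Rightarrow> (nat \<Rightarrow> 'a) \<Rightarrow> nat \<Rightarrow> real" where
  "max_sq_norm u w k = Max ((\<lambda>i. (norm (u i + w i))\<^sup>2) ` {0..k})"

text \<open>The bound on the optimality gap after iteration \<open>k\<close>, as a function of the constant
  stepsize \<open>\<alpha>\<close>, where \<open>d\<close> is the initial distance to the solution set.\<close>

definition rate_bound :: "real \<Rightarrow> real \<Rightarrow> nat \<Rightarrow> real \<Rightarrow> real" where
  "rate_bound d C k \<alpha> = (d\<^sup>2 + \<alpha>\<^sup>2 * (real k + 1) * C) / (2 * (real k + 1) * \<alpha>)"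

end

theory Submission
  imports Defs
begin

text \<open>The prox step \<open>x\<^sup>+ = prox\<^bsub>\<alpha>g\<^esub> (x - \<alpha>u)\<close> is characterised by
  \<open>(x - \<alpha>u - x\<^sup>+) \<bullet> (y - x\<^sup>+) \<le> \<alpha> (g y - g x\<^sup>+)\<close>. Combining this with the subgradient inequalities for
  \<open>u \<in> \<partial>f x\<close> and \<open>w \<in> \<partial>g x\<close> and completing a square gives
  \<open>\<parallel>x\<^sup>+ - y\<parallel>\<^sup>2 \<le> \<parallel>x - y\<parallel>\<^sup>2 - 2\<alpha> ((f + g) x - (f + g) y) + \<alpha>\<^sup>2 \<parallel>u + w\<parallel>\<^sup>2\<close>. Summing over the iterations with
  \<open>y\<close> a minimizer bounds the average optimality gap, hence the best gap and, by Jensen, the gap at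
  the ergodic mean. The optimal stepsize is the equality case of AM-GM.\<close>

section \<open>Effective domains, real inequalities and lower semicontinuity\<close>

lemma proper_eq_ereal:
  assumes "proper h" "y \<in> edom h"
  shows "h y = ereal (real_of_ereal (h y))"
  using assms by (cases "h y") (auto simp: proper_def edom_def)

lemma convex_fun_convex_on_edom:
  assumes "proper h" "convex_fun h"
  shows "convex_on (edom h) (\<lambda>y. real_of_ereal (h y))"
proof -
  have bd: "(1 - t) *\<^sub>R a + t *\<^sub>R b \<in> edom h \<and>
        real_of_ereal (h ((1 - t) *\<^sub>R a + t *\<^sub>R b))
          \<le> (1 - t) * real_of_ereal (h a) + t * real_of_ereal (h b)"
    if "a \<in> edom h" "b \<in> edom h" "0 < t" "t < 1" for a b t
  proof -
    have "h ((1 - t) *\<^sub>R a + t *\<^sub>R b) \<le> ereal (1 - t) * h a + ereal t * h b"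
      using assms(2) that by (auto simp: convex_fun_def)
    also have "\<dots> = ereal ((1 - t) * real_of_ereal (h a) + t * real_of_ereal (h b))"
      using proper_eq_ereal[OF assms(1) that(1)] proper_eq_ereal[OF assms(1) that(2)]
      by (metis plus_ereal.simps(1) times_ereal.simps(1))
    finally have le: "h ((1 - t) *\<^sub>R a + t *\<^sub>R b)
      \<le> ereal ((1 - t) * real_of_ereal (h a) + t * real_of_ereal (h b))" .
    then have mem: "(1 - t) *\<^sub>R a + t *\<^sub>R b \<in> edom h"
      by (auto simp: edom_def)
    show ?thesis
      using mem le proper_eq_ereal[OF assms(1) mem] by (metis ereal_less_eq(3))
  qed
  have "convex (edom h)"
    unfolding convex_alt using bd
    by (metis add_0 add.right_neutral diff_zero diff_self less_le scaleR_one scaleR_zero_left)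
  then show ?thesis
    by (intro convex_onI) (use bd in auto)
qed

lemma subdiff_real_inequality:
  assumes "proper h" "v \<in> subdiff h a" "a \<in> edom h" "y \<in> edom h"
  shows "real_of_ereal (h a) + v \<bullet> (y - a) \<le> real_of_ereal (h y)"
proof -
  have "h a + ereal (v \<bullet> (y - a)) \<le> h y"
    using assms(2) by (auto simp: subdiff_def)
  then show ?thesis
    using proper_eq_ereal[OF assms(1,3)] proper_eq_ereal[OF assms(1,4)]
    by (metis ereal_less_eq(3) plus_ereal.simps(1))
qed

text \<open>The liminf in \<open>lower_semicontinuous\<close> ignores the value at \<open>p\<close>
  itself. The hypothesis \<open>c < h p\<close> fills this gap, so the bound holds on a full
  neighbourhood and also covers indices with \<open>s n = p\<close>.\<close>

lemma lower_semicontinuous_eventually_less: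
  assumes "lower_semicontinuous h" "c < h p" "s \<longlonglongrightarrow> p"
  shows "\<forall>\<^sub>F n in sequentially. c < h (s n)"
proof -
  have "\<forall>\<^sub>F y in at p. c < h y"
    using assms(1,2) by (auto simp: lower_semicontinuous_def le_Liminf_iff)
  then have "\<forall>\<^sub>F y in nhds p. c < h y"
    using assms(2) by (auto simp: eventually_at_filter elim: eventually_mono)
  then show ?thesis
    using assms(3) unfolding filterlim_iff by blast
qed

section \<open>The proximal map: existence, uniqueness, variational inequality\<close>

definition prox_obj :: "real \<Rightarrow> ('a::real_inner \<Rightarrow> ereal) \<Rightarrow> 'a \<Rightarrow> 'a \<Rightarrow> real" where
  "prox_obj \<alpha> g z y = \<alpha> * real_of_ereal (g y) + 1 / 2 * (norm (y - z))\<^sup>2"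

text \<open>Outside \<open>edom g\<close> the extended objective is infinite, but
  \<open>real_of_ereal\<close> maps infinity to 0 and makes \<open>prox_obj\<close> meaningless
  there; hence the real comparison is confined to \<open>edom g\<close>.\<close>

lemma mem_minimizers_prox_iff:
  fixes g :: "'a::real_inner \<Rightarrow> ereal"
  assumes "proper g" "\<alpha> > 0"
  shows "p \<in> minimizers (\<lambda>y. ereal \<alpha> * g y + ereal (1 / 2 * (norm (y - z))\<^sup>2)) \<longleftrightarrow>
    p \<in> edom g \<and> (\<forall>y\<in>edom g. prox_obj \<alpha> g z p \<le> prox_obj \<alpha> g z y)"
proof -
  define \<phi> where "\<phi> y = ereal \<alpha> * g y + ereal (1 / 2 * (norm (y - z))\<^sup>2)" for y
  have fin: "\<phi> y = ereal (prox_obj \<alpha> g z y)" if "y \<in> edom g" for y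
    using proper_eq_ereal[OF assms(1) that]
    by (metis \<phi>_def prox_obj_def plus_ereal.simps(1) times_ereal.simps(1))
  have inf: "\<phi> y = \<infinity>" if "y \<notin> edom g" for y
    using that assms(2) by (auto simp: \<phi>_def edom_def)
  obtain p0 where "p0 \<in> edom g"
    using assms(1) by (auto simp: proper_def)
  then have "(\<forall>y. \<phi> p \<le> \<phi> y) \<longleftrightarrow>
      p \<in> edom g \<and> (\<forall>y\<in>edom g. prox_obj \<alpha> g z p \<le> prox_obj \<alpha> g z y)"
    by (metis fin inf ereal_less_eq(1,3) ereal_infty_less_eq(1) PInfty_neq_ereal(1))
  then show ?thesis
    by (simp add: minimizers_def \<phi>_def)
qed

text \<open>Minimality is tested on the segment from \<open>p\<close> to \<open>y\<close>: the
  increase of the objective is at most a linear plus a quadratic term in \<open>t\<close>, and the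
  latter disappears after division by \<open>t\<close> as \<open>t\<close> tends to 0.\<close>

lemma prox_obj_variational:
  fixes g :: "'a::real_inner \<Rightarrow> ereal"
  assumes "proper g" "convex_fun g" "p \<in> edom g" "y \<in> edom g"
    and min: "\<forall>y\<in>edom g. prox_obj \<alpha> g z p \<le> prox_obj \<alpha> g z y" and "\<alpha> > 0"
  shows "(z - p) \<bullet> (y - p) \<le> \<alpha> * (real_of_ereal (g y) - real_of_ereal (g p))"
proof -
  let ?G = "\<lambda>y. real_of_ereal (g y)"
  \<comment> \<open>\<open>A\<close> is the slack of the claim; the objective increases from
    \<open>p\<close> to the point \<open>q\<close> below by at most
    \<open>t * A + t\<^sup>2 * B\<close>.\<close>
  define A where "A = \<alpha> * (?G y - ?G p) - (z - p) \<bullet> (y - p)"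
  define B where "B = (norm (y - p))\<^sup>2 / 2"
  have cv: "convex_on (edom g) ?G"
    using convex_fun_convex_on_edom assms(1,2) by blast
  have "0 \<le> A + t * B" if t: "0 < t" "t < 1" for t
  proof -
    define q where "q = (1 - t) *\<^sub>R p + t *\<^sub>R y"
    have "q \<in> edom g"
      using convex_on_imp_convex[OF cv] assms(3,4) t by (simp add: q_def convex_alt)
    then have "prox_obj \<alpha> g z p \<le> prox_obj \<alpha> g z q"
      using min by blast
    moreover have "\<alpha> * ?G q \<le> \<alpha> * ((1 - t) * ?G p + t * ?G y)"
      using convex_onD[OF cv, of t p y] assms(3,4,6) t by (simp add: q_def)
    moreover have "(norm (q - z))\<^sup>2 =
        (norm (p - z))\<^sup>2 - 2 * t * ((z - p) \<bullet> (y - p)) + t\<^sup>2 * (norm (y - p))\<^sup>2"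
      unfolding q_def power2_norm_eq_inner
      by (simp add: algebra_simps inner_commute power2_eq_square)
    ultimately have "0 \<le> t * (A + t * B)"
      by (simp add: prox_obj_def A_def B_def algebra_simps power2_eq_square)
    then show ?thesis
      using t by (simp add: zero_le_mult_iff)
  qed
  then have "\<forall>\<^sub>F t in at_right 0. 0 \<le> A + t * B"
    by (intro eventually_at_rightI[of 0 1]) auto
  moreover have "((\<lambda>t. A + t * B) \<longlongrightarrow> A + 0 * B) (at_right 0)"
    by (intro tendsto_intros)
  ultimately have "0 \<le> A"
    using tendsto_lowerbound by fastforce
  then show ?thesis
    by (simp add: A_def)
qed

text \<open>The subgradient \<open>v\<close> gives \<open>g\<close> an affine minorant, and an
  affine function plus the quadratic is bounded below.\<close>

lemma prox_obj_bdd_below: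
  fixes g :: "'a::real_inner \<Rightarrow> ereal"
  assumes "proper g" "\<alpha> > 0" "p \<in> edom g" "v \<in> subdiff g p"
  shows "bdd_below (prox_obj \<alpha> g z ` edom g)"
proof (rule bdd_belowI2)
  fix y assume y: "y \<in> edom g"
  have "\<alpha> * (real_of_ereal (g p) + v \<bullet> (y - p)) \<le> \<alpha> * real_of_ereal (g y)"
    using subdiff_real_inequality[OF assms(1,4,3) y] assms(2) by simp
  \<comment> \<open>This square vanishes at \<open>z - \<alpha> *\<^sub>R v\<close>, where minorant
    plus quadratic is smallest; it yields the constant in the bound.\<close>
  moreover have "0 \<le> (norm (y - z + \<alpha> *\<^sub>R v))\<^sup>2"
    by simp
  then have "0 \<le> (norm (y - z))\<^sup>2 + 2 * \<alpha> * (v \<bullet> (y - z)) + \<alpha>\<^sup>2 * (norm v)\<^sup>2"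
    unfolding power2_norm_eq_inner by (simp add: algebra_simps inner_commute power2_eq_square)
  ultimately show "\<alpha> * (real_of_ereal (g p) + v \<bullet> (z - p)) - \<alpha>\<^sup>2 * (norm v)\<^sup>2 / 2 \<le> prox_obj \<alpha> g z y"
    by (simp add: prox_obj_def algebra_simps)
qed

text \<open>Strong convexity of the objective: convexity of \<open>g\<close> combined with the
  parallelogram law for \<open>a - z\<close> and \<open>b - z\<close>. It forces near-minimizers to
  lie close together.\<close>

lemma prox_obj_midpoint:
  fixes g :: "'a::real_inner \<Rightarrow> ereal"
  assumes "proper g" "convex_fun g" "\<alpha> > 0" "a \<in> edom g" "b \<in> edom g"
  shows "midpoint a b \<in> edom g"
    and "(norm (a - b))\<^sup>2 \<le>
      4 * (prox_obj \<alpha> g z a + prox_obj \<alpha> g z b - 2 * prox_obj \<alpha> g z (midpoint a b))"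
proof -
  let ?G = "\<lambda>y. real_of_ereal (g y)"
  have cv: "convex_on (edom g) ?G"
    using convex_fun_convex_on_edom assms(1,2) by blast
  have mid: "midpoint a b = (1 - 1/2) *\<^sub>R a + (1/2) *\<^sub>R b"
    by (simp add: midpoint_def scaleR_add_right)
  show "midpoint a b \<in> edom g"
    unfolding mid using convex_on_imp_convex[OF cv] assms(4,5)
    by (intro convexD_alt) auto
  have "?G (midpoint a b) \<le> (?G a + ?G b) / 2"
    unfolding mid using convex_onD[OF cv, of "1/2" a b] assms(4,5) by simp
  then have "\<alpha> * ?G (midpoint a b) \<le> \<alpha> * ((?G a + ?G b) / 2)"
    using assms(3) by simp
  moreover have "4 * (norm (midpoint a b - z))\<^sup>2 =
      2 * (norm (a - z))\<^sup>2 + 2 * (norm (b - z))\<^sup>2 - (norm (a - b))\<^sup>2"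
    unfolding midpoint_def power2_norm_eq_inner
    by (simp add: algebra_simps inner_commute)
  ultimately show "(norm (a - b))\<^sup>2 \<le>
      4 * (prox_obj \<alpha> g z a + prox_obj \<alpha> g z b - 2 * prox_obj \<alpha> g z (midpoint a b))"
    by (simp add: prox_obj_def algebra_simps)
qed

text \<open>By strong convexity a minimizing sequence is Cauchy; completeness provides its limit,
  and lower semicontinuity makes the limit a minimizer.\<close>

lemma prox_obj_attains_min:
  fixes g :: "'a::{real_inner, complete_space} \<Rightarrow> ereal"
  assumes g: "proper g" "lower_semicontinuous g" "convex_fun g" and \<alpha>: "\<alpha> > 0"
    and p0: "p0 \<in> edom g" "v \<in> subdiff g p0"
  shows "\<exists>p\<in>edom g. \<forall>y\<in>edom g. prox_obj \<alpha> g z p \<le> prox_obj \<alpha> g z y"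
proof -
  let ?P = "prox_obj \<alpha> g z"
  define m where "m = Inf (?P ` edom g)"
  have bdd: "bdd_below (?P ` edom g)"
    using prox_obj_bdd_below[OF g(1) \<alpha> p0] .
  have m_le: "m \<le> ?P y" if "y \<in> edom g" for y
    using that bdd by (auto simp: m_def intro: cInf_lower)
  have "\<exists>y\<in>edom g. ?P y < m + inverse (real (Suc n))" for n
    using cInf_lessD[of "?P ` edom g" "m + inverse (real (Suc n))"] p0(1) by (auto simp: m_def)
  then obtain s where s: "\<And>n. s n \<in> edom g" "\<And>n. ?P (s n) < m + inverse (real (Suc n))"
    by metis
  \<comment> \<open>Both objective values exceed \<open>m\<close> by less than these inverses, while
    the midpoint has value at least \<open>m\<close>.\<close>
  have dist_s: "(norm (s i - s j))\<^sup>2 \<le> 4 * (inverse (real (Suc i)) + inverse (real (Suc j)))" for i j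
    using m_le[OF prox_obj_midpoint(1)[OF g(1,3) \<alpha> s(1)[of i] s(1)[of j]]]
      prox_obj_midpoint(2)[OF g(1,3) \<alpha> s(1)[of i] s(1)[of j], of z]
      s(2)[of i] s(2)[of j] by (smt (verit))
  have "Cauchy s"
  proof (rule metric_CauchyI)
    fix e :: real assume "e > 0"
    then obtain N where N: "8 * inverse (real (Suc N)) < e\<^sup>2"
      using reals_Archimedean[of "e\<^sup>2 / 8"] by (auto simp: field_simps)
    have "dist (s i) (s j) < e" if "i \<ge> N" "j \<ge> N" for i j
    proof -
      have "inverse (real (Suc i)) \<le> inverse (real (Suc N))"
        "inverse (real (Suc j)) \<le> inverse (real (Suc N))"
        using that by (auto intro!: le_imp_inverse_le)
      then have "(norm (s i - s j))\<^sup>2 < e\<^sup>2"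
        using dist_s[of i j] N by (smt (verit))
      then show ?thesis
        using \<open>e > 0\<close> by (simp add: dist_norm power2_less_imp_less)
    qed
    then show "\<exists>N. \<forall>i\<ge>N. \<forall>j\<ge>N. dist (s i) (s j) < e"
      by blast
  qed
  then obtain p where p: "s \<longlonglongrightarrow> p"
    using Cauchy_convergent convergent_def by blast
  \<comment> \<open>The bound is the value of \<open>g p\<close> at which the objective at
    \<open>p\<close> would equal \<open>m\<close>. Stated in \<open>ereal\<close>, it also shows
    that \<open>g p\<close> is not infinite.\<close>
  have le: "g p \<le> ereal ((m - 1 / 2 * (norm (p - z))\<^sup>2) / \<alpha>)"
  proof (rule ccontr)
    assume "\<not> ?thesis"
    then obtain c where c: "(m - 1 / 2 * (norm (p - z))\<^sup>2) / \<alpha> < c" "ereal c < g p"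
      using ereal_dense2[of "ereal ((m - 1 / 2 * (norm (p - z))\<^sup>2) / \<alpha>)" "g p"] by (auto simp: not_le)
    have "\<forall>\<^sub>F n in sequentially. ereal c < g (s n)"
      using lower_semicontinuous_eventually_less[OF g(2) c(2) p] .
    then have "\<forall>\<^sub>F n in sequentially.
        \<alpha> * c + 1 / 2 * (norm (s n - z))\<^sup>2 \<le> m + inverse (real (Suc n))"
    proof eventually_elim
      case (elim n)
      then have "c < real_of_ereal (g (s n))"
        using proper_eq_ereal[OF g(1) s(1)[of n]] by (metis less_ereal.simps(1))
      then have "\<alpha> * c \<le> \<alpha> * real_of_ereal (g (s n))"
        using \<alpha> by simp
      then show ?case
        using s(2)[of n] by (simp add: prox_obj_def)
    qed
    moreover have "(\<lambda>n. \<alpha> * c + 1 / 2 * (norm (s n - z))\<^sup>2) \<longlonglongrightarrow> \<alpha> * c + 1 / 2 * (norm (p - z))\<^sup>2"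
      by (intro tendsto_intros p)
    moreover have "(\<lambda>n. m + inverse (real (Suc n))) \<longlonglongrightarrow> m + 0"
      by (intro tendsto_intros LIMSEQ_inverse_real_of_nat)
    ultimately have "\<alpha> * c + 1 / 2 * (norm (p - z))\<^sup>2 \<le> m + 0"
      using tendsto_le[OF trivial_limit_sequentially] by blast
    then show False
      using c(1) \<alpha> by (simp add: field_simps)
  qed
  then have mem: "p \<in> edom g"
    by (auto simp: edom_def)
  have "real_of_ereal (g p) \<le> (m - 1 / 2 * (norm (p - z))\<^sup>2) / \<alpha>"
    using le proper_eq_ereal[OF g(1) mem] by (metis ereal_less_eq(3))
  then have "?P p \<le> m"
    using \<alpha> by (simp add: prox_obj_def field_simps)
  then show ?thesis
    using mem m_le by (meson order_trans)
qed

text \<open>The description operator in \<open>prox\<close> calls for existence and uniqueness. For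
  uniqueness, adding the variational inequalities at two minimizers leaves their squared distance at
  most 0. The pair \<open>p0\<close>, \<open>v\<close> enters through existence.\<close>

lemma prox_characterization:
  fixes g :: "'a::{real_inner, complete_space} \<Rightarrow> ereal"
  assumes g: "proper g" "lower_semicontinuous g" "convex_fun g" and \<alpha>: "\<alpha> > 0"
    and p0: "p0 \<in> edom g" "v \<in> subdiff g p0"
  shows "prox \<alpha> g z \<in> edom g"
    and "y \<in> edom g \<Longrightarrow> (z - prox \<alpha> g z) \<bullet> (y - prox \<alpha> g z)
      \<le> \<alpha> * (real_of_ereal (g y) - real_of_ereal (g (prox \<alpha> g z)))"
proof -
  define Q where "Q p \<longleftrightarrow>
    p \<in> edom g \<and> (\<forall>y\<in>edom g. prox_obj \<alpha> g z p \<le> prox_obj \<alpha> g z y)" for p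
  have "\<exists>p. Q p"
    using prox_obj_attains_min[OF g \<alpha> p0] by (auto simp: Q_def)
  moreover have "p = q" if "Q p" "Q q" for p q
  proof -
    have "(z - p) \<bullet> (q - p) + (z - q) \<bullet> (p - q) \<le> 0"
      using prox_obj_variational[OF g(1,3), of p q \<alpha> z] prox_obj_variational[OF g(1,3), of q p \<alpha> z]
        that \<alpha> by (simp add: Q_def algebra_simps)
    then have "(p - q) \<bullet> (p - q) \<le> 0"
      by (simp add: algebra_simps inner_commute)
    then show ?thesis
      by (metis inner_gt_zero_iff not_le right_minus_eq)
  qed
  ultimately have "Q (THE p. Q p)"
    by (metis theI)
  then have Q: "Q (prox \<alpha> g z)"
    unfolding prox_def mem_minimizers_prox_iff[OF g(1) \<alpha>] Q_def .
  then show "prox \<alpha> g z \<in> edom g"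
    by (simp add: Q_def)
  show "(z - prox \<alpha> g z) \<bullet> (y - prox \<alpha> g z)
      \<le> \<alpha> * (real_of_ereal (g y) - real_of_ereal (g (prox \<alpha> g z)))" if "y \<in> edom g"
    using prox_obj_variational[OF g(1,3) _ that _ \<alpha>] Q by (simp add: Q_def)
qed

section \<open>One-step estimate and optimal stepsize\<close>

lemma forward_backward_step:
  fixes a p y u w :: "'a::real_inner"
  assumes var: "(a - \<alpha> *\<^sub>R u - p) \<bullet> (y - p) \<le> \<alpha> * (gy - gp)"
    and f: "fa + u \<bullet> (y - a) \<le> fy" and g: "ga + w \<bullet> (p - a) \<le> gp" and \<alpha>: "\<alpha> > 0"
  shows "(norm (p - y))\<^sup>2
    \<le> (norm (a - y))\<^sup>2 - 2 * \<alpha> * ((fa + ga) - (fy + gy)) + \<alpha>\<^sup>2 * (norm (u + w))\<^sup>2"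
proof -
  have "\<alpha> * (fa + u \<bullet> (y - a)) \<le> \<alpha> * fy" "\<alpha> * (ga + w \<bullet> (p - a)) \<le> \<alpha> * gp"
    using f g \<alpha> by simp_all
  \<comment> \<open>The three inequalities leave \<open>- (norm (p - a))\<^sup>2 - 2 * \<alpha> *
    ((u + w) \<bullet> (p - a))\<close>, which this square bounds by
    \<open>\<alpha>\<^sup>2 * (norm (u + w))\<^sup>2\<close>.\<close>
  moreover have "0 \<le> (norm (p - a + \<alpha> *\<^sub>R (u + w)))\<^sup>2"
    by simp
  ultimately show ?thesis
    using var unfolding power2_norm_eq_inner
    by (simp add: algebra_simps inner_commute power2_eq_square)
qed

text \<open>With \<open>c = sqrt C\<close> and \<open>r = sqrt (real k + 1)\<close> the numerator is
  the sum of the squares of \<open>d\<close> and \<open>\<beta> * r * c\<close>, hence at least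
  twice their product. Equality holds when the two agree, which gives the stated stepsize.\<close>

lemma rate_bound_optimal:
  assumes "d > 0" "C > 0" "\<alpha> = d / sqrt C * (1 / sqrt (real k + 1))"
  shows "rate_bound d C k \<alpha> = d * sqrt C / sqrt (real k + 1)"
    and "\<beta> > 0 \<Longrightarrow> d * sqrt C / sqrt (real k + 1) \<le> rate_bound d C k \<beta>"
proof -
  define c r where "c = sqrt C" and "r = sqrt (real k + 1)"
  have c: "c > 0" "C = c\<^sup>2" and r: "r > 0" "real k + 1 = r\<^sup>2"
    using assms(2) by (simp_all add: c_def r_def)
  have a: "\<alpha> = d / (c * r)"
    using assms(3) by (simp add: c_def r_def)
  show "rate_bound d C k \<alpha> = d * sqrt C / sqrt (real k + 1)"
    unfolding rate_bound_def c_def[symmetric] r_def[symmetric] a c(2) r(2)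
    using assms(1) c(1) r(1) by (simp add: field_simps power2_eq_square)
  show "d * sqrt C / sqrt (real k + 1) \<le> rate_bound d C k \<beta>" if "\<beta> > 0"
  proof -
    have "d * c / r = 2 * d * (\<beta> * r * c) / (2 * r\<^sup>2 * \<beta>)"
      using that r(1) by (simp add: field_simps power2_eq_square)
    also have "\<dots> \<le> (d\<^sup>2 + (\<beta> * r * c)\<^sup>2) / (2 * r\<^sup>2 * \<beta>)"
      using that r(1) sum_squares_bound[of d "\<beta> * r * c"] by (intro divide_right_mono) auto
    also have "\<dots> = rate_bound d C k \<beta>"
      unfolding rate_bound_def c(2) r(2) by (simp add: power_mult_distrib)
    finally show ?thesis
      by (simp add: c_def r_def)
  qed
qed

section \<open>Convergence rates of the best value and the ergodic mean\<close>

theorem corollary2p4: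
  fixes f g :: "'a::{real_inner, complete_space} \<Rightarrow> ereal"
    and x u w :: "nat \<Rightarrow> 'a" and \<alpha> :: real and k :: nat
  assumes nontrivial: "\<exists>a::'a. a \<noteq> 0"
    and f: "proper f" "lower_semicontinuous f" "convex_fun f"
    and g: "proper g" "lower_semicontinuous g" "convex_fun g"
    and dom: "edom g \<subseteq> edom f"
    and A1: "subdiff_bounded_on_bounded f g"
    and A2: "bounded_subgradient_selection g"
    and pss: "PSS f g (\<lambda>_. \<alpha>) u x"
    and sol: "minimizers (\<lambda>y. f y + g y) \<noteq> {}"
    and w: "\<And>i. i \<le> k \<Longrightarrow> w i \<in> subdiff g (x i)"
  shows "best_value (\<lambda>y. f y + g y) x k - (INF y. f y + g y)
           \<le> ereal (rate_bound (infdist (x 0) (minimizers (\<lambda>y. f y + g y))) (max_sq_norm u w k) k \<alpha>)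
       \<and> f (ergodic (\<lambda>_. \<alpha>) x k) + g (ergodic (\<lambda>_. \<alpha>) x k) - (INF y. f y + g y)
           \<le> ereal (rate_bound (infdist (x 0) (minimizers (\<lambda>y. f y + g y))) (max_sq_norm u w k) k \<alpha>)
       \<and> (\<alpha> = infdist (x 0) (minimizers (\<lambda>y. f y + g y)) / sqrt (max_sq_norm u w k)
                 * (1 / sqrt (real k + 1)) \<longrightarrow>
            rate_bound (infdist (x 0) (minimizers (\<lambda>y. f y + g y))) (max_sq_norm u w k) k \<alpha>
              \<le> infdist (x 0) (minimizers (\<lambda>y. f y + g y)) * sqrt (max_sq_norm u w k)
                 / sqrt (real k + 1)
          \<and> (\<forall>\<beta>>0. rate_bound (infdist (x 0) (minimizers (\<lambda>y. f y + g y))) (max_sq_norm u w k) k \<alpha>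
              \<le> rate_bound (infdist (x 0) (minimizers (\<lambda>y. f y + g y))) (max_sq_norm u w k) k \<beta>))"
proof -
  define S where "S = minimizers (\<lambda>y. f y + g y)"
  define d where "d = infdist (x 0) S"
  define C where "C = max_sq_norm u w k"
  define F where "F y = real_of_ereal (f y) + real_of_ereal (g y)" for y
  define K where "K = real k + 1"
  have K: "K > 0" "real (card {0..k}) = K"
    by (simp_all add: K_def)
  have x0: "x 0 \<in> edom g" and \<alpha>: "\<alpha> > 0" and u: "\<And>i. u i \<in> subdiff f (x i)"
    and xS: "\<And>i. x (Suc i) = prox \<alpha> g (x i - \<alpha> *\<^sub>R u i)"
    using pss by (auto simp: PSS_def)
  have w0: "w 0 \<in> subdiff g (x 0)"
    using w by simp
  \<comment> \<open>The subgradient \<open>w 0\<close> at \<open>x 0\<close> provides the lower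
    bound behind the existence of every prox point.\<close>
  note px = prox_characterization[OF g \<alpha> x0 w0]
  have xg: "x i \<in> edom g" for i
    by (cases i) (use x0 px(1) xS in auto)
  have F: "f y + g y = ereal (F y)" if "y \<in> edom g" for y
    using proper_eq_ereal[OF f(1), of y] proper_eq_ereal[OF g(1) that] that dom
    by (metis F_def plus_ereal.simps(1) subsetD)
  \<comment> \<open>The value at \<open>x 0\<close> is finite, so the value at a minimizer is too,
    and properness then makes each summand finite.\<close>
  have S_dom: "y \<in> edom g" if "y \<in> S" for y
  proof -
    have "f y + g y \<le> ereal (F (x 0))"
      using that F[OF x0] by (simp add: S_def minimizers_def) (metis F x0)
    then show ?thesis
      using f(1) by (cases "f y"; cases "g y") (auto simp: edom_def proper_def)
  qed
  obtain y0 where y0: "y0 \<in> S"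
    using sol by (auto simp: S_def)
  have inf: "(INF y. f y + g y) = ereal (F y)" if "y \<in> S" for y
  proof -
    have "(INF y. f y + g y) = f y + g y"
      using that by (intro antisym INF_lower INF_greatest) (auto simp: S_def minimizers_def)
    then show ?thesis
      using F S_dom that by simp
  qed
  have FS: "F y = F y0" if "y \<in> S" for y
    using inf that y0 by (metis ereal.inject)
  have C: "(norm (u i + w i))\<^sup>2 \<le> C" if "i \<le> k" for i
    unfolding C_def max_sq_norm_def using that by (intro Max_ge) auto
  have step: "(norm (x (Suc i) - y))\<^sup>2
      \<le> (norm (x i - y))\<^sup>2 - 2 * \<alpha> * (F (x i) - F y) + \<alpha>\<^sup>2 * C"
    if "i \<le> k" "y \<in> edom g" for i y
  proof -
    have "(norm (x (Suc i) - y))\<^sup>2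
      \<le> (norm (x i - y))\<^sup>2 - 2 * \<alpha> * (F (x i) - F y) + \<alpha>\<^sup>2 * (norm (u i + w i))\<^sup>2"
      unfolding F_def
    proof (rule forward_backward_step[OF _ _ _ \<alpha>])
      show "(x i - \<alpha> *\<^sub>R u i - x (Suc i)) \<bullet> (y - x (Suc i))
          \<le> \<alpha> * (real_of_ereal (g y) - real_of_ereal (g (x (Suc i))))"
        unfolding xS using px(2) that(2) .
      show "real_of_ereal (f (x i)) + u i \<bullet> (y - x i) \<le> real_of_ereal (f y)"
        using subdiff_real_inequality[OF f(1) u] xg that(2) dom by blast
      show "real_of_ereal (g (x i)) + w i \<bullet> (x (Suc i) - x i) \<le> real_of_ereal (g (x (Suc i)))"
        using subdiff_real_inequality[OF g(1) w[OF that(1)]] xg by blast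
    qed
    then show ?thesis
      using mult_left_mono[OF C[OF that(1)], of "\<alpha>\<^sup>2"] by simp
  qed
  \<comment> \<open>\<open>y0\<close> only records the optimal value, while \<open>y\<close> stays
    free so that the distance can be minimized afterwards. The sum has \<open>K = k + 1\<close>
    terms, and the final distance, from \<open>x (Suc k)\<close>, is dropped.\<close>
  have telescope: "(\<Sum>i=0..k. F (x i) - F y0) * (2 * \<alpha>) \<le> (dist (x 0) y)\<^sup>2 + \<alpha>\<^sup>2 * K * C"
    if "y \<in> S" for y
  proof -
    have "(\<Sum>i=0..k. 2 * \<alpha> * (F (x i) - F y0))
        \<le> (\<Sum>i=0..k. ((norm (x i - y))\<^sup>2 - (norm (x (Suc i) - y))\<^sup>2) + \<alpha>\<^sup>2 * C)"
      using step[OF _ S_dom[OF that]] FS[OF that] by (intro sum_mono) (auto simp: algebra_simps)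
    also have "\<dots> = (norm (x 0 - y))\<^sup>2 - (norm (x (Suc k) - y))\<^sup>2 + K * (\<alpha>\<^sup>2 * C)"
      unfolding sum.distrib sum_constant K(2)
      using sum_telescope[of "\<lambda>i. (norm (x i - y))\<^sup>2" k] by (simp add: atMost_atLeast0)
    also have "\<dots> \<le> (dist (x 0) y)\<^sup>2 + \<alpha>\<^sup>2 * K * C"
      by (simp add: dist_norm algebra_simps)
    finally show ?thesis
      by (simp add: sum_distrib_left[symmetric] mult.commute)
  qed
  have "(\<Sum>i=0..k. F (x i) - F y0) * (2 * \<alpha>) - \<alpha>\<^sup>2 * K * C \<le> d\<^sup>2"
  proof -
    \<comment> \<open>The infimum is over distances, not their squares, so square roots are taken
      first and no nearest point of \<open>S\<close> is chosen. A negative radicand is harmless, as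
      \<open>sqrt\<close> is then negative.\<close>
    have "sqrt ((\<Sum>i=0..k. F (x i) - F y0) * (2 * \<alpha>) - \<alpha>\<^sup>2 * K * C) \<le> dist (x 0) y"
      if "y \<in> S" for y
      using telescope[OF that] by (intro real_le_lsqrt) auto
    then have "sqrt ((\<Sum>i=0..k. F (x i) - F y0) * (2 * \<alpha>) - \<alpha>\<^sup>2 * K * C) \<le> d"
      unfolding d_def infdist_def using y0 by (auto intro!: cINF_greatest simp del: real_sqrt_le_iff)
    then show ?thesis
      by (rule sqrt_le_D)
  qed
  then have avg: "(\<Sum>i=0..k. F (x i) - F y0) / K \<le> rate_bound d C k \<alpha>"
    using K(1) \<alpha> unfolding rate_bound_def K_def[symmetric] by (simp add: field_simps)
  \<comment> \<open>The average gap as a convex combination minus the optimal value, the form that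
    Jensen's inequality produces.\<close>
  have avg_F: "(\<Sum>i=0..k. F (x i) - F y0) / K = (\<Sum>i=0..k. (1 / K) * F (x i)) - F y0"
    unfolding sum_subtractf sum_constant K(2) sum_distrib_left[symmetric]
    using K(1) by (simp add: field_simps)
  have best: "best_value (\<lambda>y. f y + g y) x k - (INF y. f y + g y) \<le> ereal (rate_bound d C k \<alpha>)"
  proof -
    have "best_value (\<lambda>y. f y + g y) x k \<in> (\<lambda>i. ereal (F (x i))) ` {0..k}"
      unfolding best_value_def F[OF xg] by (intro Min_in) auto
    then obtain j where j: "best_value (\<lambda>y. f y + g y) x k = ereal (F (x j))"
      by auto
    have "F (x j) \<le> F (x i)" if "i \<le> k" for i
    proof -
      have "ereal (F (x j)) \<le> ereal (F (x i))"
        unfolding j[symmetric] best_value_def F[OF xg] using that by (intro Min_le) auto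
      then show ?thesis
        by simp
    qed
    then have "K * (F (x j) - F y0) \<le> (\<Sum>i=0..k. F (x i) - F y0)"
      using sum_bounded_below[of "{0..k}" "F (x j) - F y0" "\<lambda>i. F (x i) - F y0"] K(2) by simp
    then have "F (x j) - F y0 \<le> (\<Sum>i=0..k. F (x i) - F y0) / K"
      using K(1) by (simp add: field_simps)
    then show ?thesis
      using avg by (simp add: j inf[OF y0])
  qed
  have cvg: "convex_on (edom g) (\<lambda>y. real_of_ereal (g y))"
    using convex_fun_convex_on_edom g by blast
  have "convex_on (edom g) (\<lambda>y. real_of_ereal (f y))"
    using convex_on_subset[OF convex_fun_convex_on_edom[OF f(1,3)] dom]
      convex_on_imp_convex[OF cvg] by blast
  then have cv: "convex_on (edom g) F"
    unfolding F_def using cvg by (rule convex_on_add)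
  \<comment> \<open>For a constant stepsize all ergodic weights reduce to
    \<open>1 / K\<close>.\<close>
  have erg_eq: "ergodic (\<lambda>_. \<alpha>) x k = (\<Sum>i=0..k. (1 / K) *\<^sub>R x i)"
    unfolding ergodic_def sum_constant K(2) using \<alpha> K(1)
    by (simp add: scaleR_sum_right)
  have sum1: "(\<Sum>i=0..k. 1 / K) = 1"
    unfolding sum_constant K(2) using K(1) by simp
  have erg_dom: "ergodic (\<lambda>_. \<alpha>) x k \<in> edom g"
    unfolding erg_eq using convex_on_imp_convex[OF cv] sum1 K(1) xg
    by (intro convex_sum) auto
  have "F (ergodic (\<lambda>_. \<alpha>) x k) \<le> (\<Sum>i=0..k. (1 / K) * F (x i))"
    unfolding erg_eq using K(1) xg sum1
    by (intro convex_on_sum[OF _ _ cv]) auto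
  then have erg: "f (ergodic (\<lambda>_. \<alpha>) x k) + g (ergodic (\<lambda>_. \<alpha>) x k) - (INF y. f y + g y)
      \<le> ereal (rate_bound d C k \<alpha>)"
    using avg avg_F by (simp add: F[OF erg_dom] inf[OF y0])
  have "rate_bound d C k \<alpha> \<le> d * sqrt C / sqrt (real k + 1)
      \<and> (\<forall>\<beta>>0. rate_bound d C k \<alpha> \<le> rate_bound d C k \<beta>)"
    if eq: "\<alpha> = d / sqrt C * (1 / sqrt (real k + 1))"
  proof -
    have "0 \<le> C"
      using C[of 0] by (smt (verit) zero_le_power2 le0)
    \<comment> \<open>If \<open>C\<close> or \<open>d\<close> were 0, then \<open>eq\<close> would
      give \<open>\<alpha> = 0\<close>, since division by 0 yields 0; but the stepsize is
      positive.\<close>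
    moreover have "C \<noteq> 0" "d \<noteq> 0"
      using eq \<alpha> by auto
    moreover have "d \<ge> 0"
      by (simp add: d_def infdist_nonneg)
    ultimately have "d > 0" "C > 0"
      by auto
    then show ?thesis
      using rate_bound_optimal[OF _ _ eq] by auto
  qed
  then show ?thesis
    using best erg unfolding d_def C_def S_def by blast
qed

end
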